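(* Let $a,b,c,d>0$, $P_T>0$, $R_1^{min},R_2^{min}\ge 0$, and put $\beta_i=2^{R_i^{min}}-1$ for $i=1,2$. Define $$P_1^{worst}=\frac{\beta_1(1+bP_T)}{a+\beta_1b},\qquad P_2^{worst}=\frac{\beta_2(1+cP_T)}{d+\beta_2c},\qquad \tilde P=P_T-P_1^{worst}-P_2^{worst},$$ and assume $\tilde P>0$. Consider the maximization of $$\log_2\left(1+\frac{a(P_1^{worst}+\tilde P_1)}{b(P_2^{worst}+\tilde P_2)+1}\right)+\log_2\left(1+\frac{d(P_2^{worst}+\tilde P_2)}{c(P_1^{worst}+\tilde P_1)+1}\right)$$ over all $\tilde P_1,\tilde P_2\ge 0$ with $\tilde P_1+\tilde P_2\le\tilde P$. If $(\tilde P_1^*,\tilde P_2^* )$ is a maximizer, then either $(\tilde P_1^*,\tilde P_2^* )=(0,\tilde P)$, or $(\tilde P_1^*,\tilde P_2^* )=(\tilde P,0)$, or $\tilde P_2^*=\tilde P-\tilde P_1^*$ and $\tilde P_1^*$ is a solution of the equation $$A_2\tilde P_1^2+B_2\tilde P_1+C_2=0,$$ where $$A_2=a_2'bce_2'+b_2'cc_2'e_2'+b_2'bcd_2'-b_2'be_2'f_2',$$ $$B_2=2a_2'bcd_2'+2b_2'c_2'e_2'f_2',$$ $$C_2=a_2'c_2'e_2'f_2'+a_2'bd_2'f_2'+b_2'c_2'd_2'f_2'-a_2'cc_2'd_2',$$ with $$a_2'=1+aP_1^{worst}+bP_2^{worst}+b\tilde P,\qquad b_2'=a-b,\qquad c_2'=1+bP_2^{worst}+b\tilde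 P,$$ $$d_2'=1+cP_1^{worst}+dP_2^{worst}+d\tilde P,\qquad e_2'=c-d,\qquad f_2'=1+cP_1^{worst}.$$
   Context: Setting: two transmitter-receiver (TX-RX) pairs interfere in one frequency band and share a total power budget $P_T$. If $g_{ji}$ is the channel gain from TX $j$ to RX $i$ and $\sigma^2$ the noise power, then $a=g_{11}/\sigma^2$, $d=g_{22}/\sigma^2$ (direct gains), $b=g_{21}/\sigma^2$, $c=g_{12}/\sigma^2$ (interference gains). With powers $P_1,P_2$ the rates are $R_1=\log_2\big(1+\frac{aP_1}{bP_2+1}\big)$ and $R_2=\log_2\big(1+\frac{dP_2}{cP_1+1}\big)$; $R_i^{min}$ is the minimum target rate of pair $i$. $P_i^{worst}$ is the power with which TX $i$ attains rate exactly $R_i^{min}$ when the other TX uses all of the remaining power $P_T-P_i^{worst}$, $\tilde P$ is the power left over, and $\tilde P_i$ is the part of $\tilde P$ given to TX $i$, so that $P_i=P_i^{worst}+\tilde P_i$. Primes on symbols denote new constants, not derivatives. *)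

theory Defs
  imports Complex_Main
begin

text \<open>Rate of a pair with direct gain \<open>g\<close> and interference gain \<open>h\<close> (both normalised by the
  noise power), where \<open>p\<close> is the power of its own transmitter and \<open>q\<close> that of the other one.\<close>

definition rate :: "real \<Rightarrow> real \<Rightarrow> real \<Rightarrow> real \<Rightarrow> real" where
  "rate g h p q = log 2 (1 + g * p / (h * q + 1))"

text \<open>The \<open>p\<close> solving \<open>g * p / (h * (P\<^sub>T - p) + 1) = 2 powr R - 1\<close>, i.e. the power attaining
  rate exactly \<open>R\<close> when the other transmitter uses all of \<open>P\<^sub>T - p\<close>.\<close>

definition worst_power :: "real \<Rightarrow> real \<Rightarrow> real \<Rightarrow> real \<Rightarrow> real" where
  "worst_power g h P\<^sub>T R = (let \<beta> = 2 powr R - 1 in \<beta> * (1 + h * P\<^sub>T) / (g + \<beta> * h))"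

definition sum_rate :: "real \<Rightarrow> real \<Rightarrow> real \<Rightarrow> real \<Rightarrow> real \<times> real \<Rightarrow> real" where
  "sum_rate a b c d = (\<lambda>(P1, P2). rate a b P1 P2 + rate d c P2 P1)"

definition feasible :: "real \<Rightarrow> real \<times> real \<Rightarrow> bool" where
  "feasible P = (\<lambda>(x, y). 0 \<le> x \<and> 0 \<le> y \<and> x + y \<le> P)"

end

theory Submission
  imports Defs
begin

text \<open>Multiplying both powers by a factor \<open>t > 1\<close> amounts to dividing the noise by \<open>t\<close> and hence
  increases the sum rate, so a maximizer exhausts the power budget. On the segment
  \<open>P1 + P2 = P\<^sub>T\<close> the sum rate is the logarithm of a quotient of products of affine functions of
  \<open>P1\<close>, and the vanishing of its derivative at an interior maximizer is, after clearing
  denominators, the quadratic equation (the cubic terms cancel).\<close>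

lemma worst_power_nonneg:
  assumes "g > 0" "h > 0" "P > 0" "R \<ge> 0"
  shows "worst_power g h P R \<ge> 0"
proof -
  have "2 powr R - 1 \<ge> (0::real)"
    using assms ge_one_powr_ge_zero[of 2 R] by simp
  then show ?thesis
    using assms unfolding worst_power_def Let_def by simp
qed

text \<open>After cross-multiplying, the terms in \<open>g * h * p * q\<close> cancel and
  \<open>g * p < g * (t * p)\<close> remains: signal and interference grow alike while the noise 1
  stays fixed. Strictness needs the pair's own power to be positive.\<close>

lemma rate_scale_less:
  assumes "g > 0" "h > 0" "p > 0" "q \<ge> 0" "t > 1"
  shows "rate g h p q < rate g h (t * p) (t * q)"
proof -
  have pos: "h * q + 1 > 0" "h * (t * q) + 1 > 0"
    using assms by (simp_all add: add_nonneg_pos)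
  have "g * p * (h * (t * q) + 1) < g * (t * p) * (h * q + 1)"
    using assms by (simp add: algebra_simps)
  then have "g * p / (h * q + 1) < g * (t * p) / (h * (t * q) + 1)"
    using pos by (simp add: divide_simps)
  moreover have "g * p / (h * q + 1) \<ge> 0"
    using assms pos by simp
  ultimately show ?thesis
    unfolding rate_def by simp
qed

lemma rate_scale_le:
  assumes "g > 0" "h > 0" "p \<ge> 0" "q \<ge> 0" "t > 1"
  shows "rate g h p q \<le> rate g h (t * p) (t * q)"
proof (cases "p = 0")
  case True
  then show ?thesis by (simp add: rate_def)
next
  case False
  then show ?thesis using rate_scale_less[of g h p q t] assms by simp
qed

lemma sum_rate_scale_less:
  assumes "a > 0" "b > 0" "c > 0" "d > 0" "p \<ge> 0" "q \<ge> 0" "p + q > 0" "t > 1"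
  shows "sum_rate a b c d (p, q) < sum_rate a b c d (t * p, t * q)"
proof (cases "p > 0")
  case True
  then show ?thesis
    using rate_scale_less[of a b p q t] rate_scale_le[of d c q p t] assms
    by (simp add: sum_rate_def)
next
  case False
  then show ?thesis
    using rate_scale_le[of a b p q t] rate_scale_less[of d c q p t] assms
    by (simp add: sum_rate_def)
qed

text \<open>Splits the rate into logarithms of affine functions of the powers, so that each can be
  differentiated on its own.\<close>

lemma rate_eq_ln:
  assumes "g > 0" "h > 0" "p \<ge> 0" "q \<ge> 0"
  shows "rate g h p q = (ln (1 + g * p + h * q) - ln (1 + h * q)) / ln 2"
proof -
  have pos: "1 + h * q > 0" "1 + g * p + h * q > 0"
    using assms by (simp_all add: add_pos_nonneg)
  then have "1 + g * p / (h * q + 1) = (1 + g * p + h * q) / (1 + h * q)"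
    by (simp add: field_simps)
  then show ?thesis
    using pos by (simp add: rate_def log_def ln_div)
qed

lemma sum_rate_maximizer_no_slack:
  assumes pos: "a > 0" "b > 0" "c > 0" "d > 0"
    and w: "p \<ge> 0" "q \<ge> 0" and P: "P > 0"
    and feas: "feasible P (x, y)"
    and max: "\<And>u v. feasible P (u, v) \<Longrightarrow>
      sum_rate a b c d (p + u, q + v) \<le> sum_rate a b c d (p + x, q + y)"
  shows "x + y = P"
proof (rule ccontr)
  assume "x + y \<noteq> P"
  with feas have xy: "x \<ge> 0" "y \<ge> 0" "x + y < P"
    by (auto simp: feasible_def)
  show False
  proof (cases "p + x + (q + y) > 0")
    case True
    \<comment> \<open>The factor that makes the scaled total powers use up exactly
      \<open>p + q + P\<close>. Since scaling only raises each power, the base parts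
      \<open>p\<close> and \<open>q\<close> can be subtracted again to leave nonnegative
      increments.\<close>
    define t where "t = (p + q + P) / (p + x + (q + y))"
    have t: "t > 1"
      using True xy by (simp add: t_def)
    have sum: "t * (p + x) + t * (q + y) = p + q + P"
    proof -
      have "t * (p + x) + t * (q + y) = t * (p + x + (q + y))"
        by (simp only: distrib_left)
      then show ?thesis
        using True by (simp add: t_def)
    qed
    have ge: "t * (p + x) \<ge> p + x" "t * (q + y) \<ge> q + y"
      using t w xy mult_right_mono[of 1 t "p + x"] mult_right_mono[of 1 t "q + y"] by simp_all
    have "feasible P (t * (p + x) - p, t * (q + y) - q)"
      using ge xy sum by (simp add: feasible_def)
    from max[OF this] show False
      using sum_rate_scale_less[of a b c d "p + x" "q + y" t] pos w xy True t by simp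
  next
    case False
    then have z: "p = 0" "q = 0" "x = 0" "y = 0"
      using w xy by auto
    \<comment> \<open>Scaling cannot move the zero allocation. Giving the whole budget to the first
      transmitter beats its sum rate 0.\<close>
    have "feasible P (P, 0)"
      using P by (simp add: feasible_def)
    from max[OF this] z have "log 2 (1 + a * P) \<le> 0"
      by (simp add: sum_rate_def rate_def)
    moreover have "a * P > 0"
      using pos P by simp
    ultimately show False
      by (simp add: add_pos_pos)
  qed
qed

text \<open>The first-order condition, for arbitrary coefficients. Positivity of the affine
  functions is required only at \<open>x\<close>, the one point where the derivative is
  taken.\<close>

lemma log_ratio_stationary:
  fixes a2 b2 c2 d2 e2 f2 b c x r :: real
  assumes pos: "a2 + b2 * x > 0" "d2 + e2 * x > 0" "c2 - b * x > 0" "f2 + c * x > 0"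
    and r: "r > 0"
    and max: "\<And>t. \<bar>x - t\<bar> < r \<Longrightarrow>
        ln (a2 + b2 * t) + ln (d2 + e2 * t) - ln (c2 - b * t) - ln (f2 + c * t)
      \<le> ln (a2 + b2 * x) + ln (d2 + e2 * x) - ln (c2 - b * x) - ln (f2 + c * x)"
  shows "(a2 * b * c * e2 + b2 * c * c2 * e2 + b2 * b * c * d2 - b2 * b * e2 * f2) * x\<^sup>2
    + (2 * a2 * b * c * d2 + 2 * b2 * c2 * e2 * f2) * x
    + (a2 * c2 * e2 * f2 + a2 * b * d2 * f2 + b2 * c2 * d2 * f2 - a2 * c * c2 * d2) = 0"
proof -
  let ?f = "\<lambda>t. ln (a2 + b2 * t) + ln (d2 + e2 * t) - ln (c2 - b * t) - ln (f2 + c * t)"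
  let ?X = "a2 + b2 * x" and ?Y = "d2 + e2 * x" and ?Z = "c2 - b * x" and ?W = "f2 + c * x"
  have "(?f has_real_derivative (b2 / ?X + e2 / ?Y + b / ?Z - c / ?W)) (at x)"
    using pos by (auto intro!: derivative_eq_intros simp: divide_inverse)
  then have "b2 / ?X + e2 / ?Y + b / ?Z - c / ?W = 0"
    by (rule DERIV_local_max[OF _ r]) (use max in blast)
  moreover have "b2 / ?X + e2 / ?Y + b / ?Z - c / ?W =
      (b2 * ?Y * ?Z * ?W + e2 * ?X * ?Z * ?W + b * ?X * ?Y * ?W - c * ?X * ?Y * ?Z)
        / (?X * ?Y * ?Z * ?W)"
    using pos by (simp add: add_divide_distrib diff_divide_distrib)
  ultimately have "b2 * ?Y * ?Z * ?W + e2 * ?X * ?Z * ?W + b * ?X * ?Y * ?W - c * ?X * ?Y * ?Z = 0"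
    using pos by simp
  \<comment> \<open>The four products contribute \<open>b * b2 * c * e2\<close> to the coefficient
    of the cube of \<open>x\<close>, twice with each sign; what is left is the quadratic
    itself.\<close>
  then show ?thesis
    by algebra
qed

theorem theorem5:
  fixes a b c d P\<^sub>T R1min R2min P1w P2w Pt x y :: real
    and a2 b2 c2 d2 e2 f2 A2 B2 C2 :: real
  assumes "a > 0" "b > 0" "c > 0" "d > 0" "P\<^sub>T > 0" "R1min \<ge> 0" "R2min \<ge> 0"
    and "P1w = worst_power a b P\<^sub>T R1min"
    and "P2w = worst_power d c P\<^sub>T R2min"
    and "Pt = P\<^sub>T - P1w - P2w"
    and "Pt > 0"
    and "a2 = 1 + a * P1w + b * P2w + b * Pt"
    and "b2 = a - b"
    and "c2 = 1 + b * P2w + b * Pt"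
    and "d2 = 1 + c * P1w + d * P2w + d * Pt"
    and "e2 = c - d"
    and "f2 = 1 + c * P1w"
    and "A2 = a2 * b * c * e2 + b2 * c * c2 * e2 + b2 * b * c * d2 - b2 * b * e2 * f2"
    and "B2 = 2 * a2 * b * c * d2 + 2 * b2 * c2 * e2 * f2"
    and "C2 = a2 * c2 * e2 * f2 + a2 * b * d2 * f2 + b2 * c2 * d2 * f2 - a2 * c * c2 * d2"
    and "is_arg_max (\<lambda>(u, v). sum_rate a b c d (P1w + u, P2w + v)) (feasible Pt) (x, y)"
  shows "(x, y) = (0, Pt) \<or> (x, y) = (Pt, 0) \<or>
         (y = Pt - x \<and> A2 * x^2 + B2 * x + C2 = 0)"
proof -
  note gains = assms(1-4)
  have w: "P1w \<ge> 0" "P2w \<ge> 0"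
    using assms(1-9) worst_power_nonneg by simp_all
  have feas: "feasible Pt (x, y)"
    using assms(21) by (simp add: is_arg_max_def)
  have max: "sum_rate a b c d (P1w + u, P2w + v) \<le> sum_rate a b c d (P1w + x, P2w + y)"
    if "feasible Pt (u, v)" for u v
    using assms(21) that unfolding is_arg_max_def by (auto simp: not_less)
  have xy: "x \<ge> 0" "y \<ge> 0" "y = Pt - x"
    using sum_rate_maximizer_no_slack[OF gains w assms(11) feas max] feas
    by (auto simp: feasible_def)
  show ?thesis
  proof (cases "x = 0 \<or> x = Pt")
    case True
    then show ?thesis using xy by auto
  next
    case False
    \<comment> \<open>The distance from \<open>x\<close> to the nearer end of the segment, so every
      \<open>t\<close> closer to \<open>x\<close> than this is still an admissible share.\<close>
    define r where "r = min x (Pt - x)"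
    have r: "r > 0"
      using False xy by (simp add: r_def)
    \<comment> \<open>Identifies the constants: \<open>a2 + b2 * t\<close> and
      \<open>d2 + e2 * t\<close> are noise plus everything received at RX 1 and RX 2, while
      \<open>c2 - b * t\<close> and \<open>f2 + c * t\<close> are noise plus interference
      there.\<close>
    have ln_form: "sum_rate a b c d (P1w + t, P2w + (Pt - t)) =
        (ln (a2 + b2 * t) + ln (d2 + e2 * t) - ln (c2 - b * t) - ln (f2 + c * t)) / ln 2"
      if "0 \<le> t" "t \<le> Pt" for t
    proof -
      have "1 + a * (P1w + t) + b * (P2w + (Pt - t)) = a2 + b2 * t"
        "1 + b * (P2w + (Pt - t)) = c2 - b * t"
        "1 + d * (P2w + (Pt - t)) + c * (P1w + t) = d2 + e2 * t"
        "1 + c * (P1w + t) = f2 + c * t"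
        unfolding assms(12-17) by (simp_all add: algebra_simps)
      then show ?thesis
        using rate_eq_ln[of a b "P1w + t" "P2w + (Pt - t)"]
          rate_eq_ln[of d c "P2w + (Pt - t)" "P1w + t"] gains w that
        by (simp add: sum_rate_def add_divide_distrib diff_divide_distrib)
    qed
    have "A2 * x\<^sup>2 + B2 * x + C2 = 0"
      unfolding assms(18-20)
    proof (rule log_ratio_stationary[OF _ _ _ _ r])
      \<comment> \<open>Once expanded, each of the four affine functions at \<open>x\<close> is 1
        plus some of these nonnegative terms.\<close>
      have nn: "a * P1w \<ge> 0" "b * P2w \<ge> 0" "c * P1w \<ge> 0" "d * P2w \<ge> 0" "a * x \<ge> 0" "c * x \<ge> 0"
        "b * (Pt - x) \<ge> 0" "d * (Pt - x) \<ge> 0"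
        using gains w xy by auto
      then show "a2 + b2 * x > 0" "d2 + e2 * x > 0" "c2 - b * x > 0" "f2 + c * x > 0"
        unfolding assms(12-17) by (simp_all add: algebra_simps)
    next
      fix t assume "\<bar>x - t\<bar> < r"
      then have t: "0 \<le> t" "t \<le> Pt"
        by (auto simp: r_def)
      then have "feasible Pt (t, Pt - t)"
        by (simp add: feasible_def)
      from max[OF this]
      show "ln (a2 + b2 * t) + ln (d2 + e2 * t) - ln (c2 - b * t) - ln (f2 + c * t)
        \<le> ln (a2 + b2 * x) + ln (d2 + e2 * x) - ln (c2 - b * x) - ln (f2 + c * x)"
        using ln_form[OF t] ln_form[of x] xy by (simp add: divide_le_cancel)
    qed
    then show ?thesis using xy by simp
  qed
qed

end
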